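(* Let $\bar a=(a_1,a_2,a_3,a_4)$, $\bar p=(p_1,p_2,p_3,p_4)$, $\bar x=(x_1,x_2,x_3,x_4)$, $\bar q=(q_1,q_2,q_3,q_4)$ be complex vectors with $a_ix_ip_iq_i\neq 0$ for $1\le i\le 4$, and put $K:=a_1a_2a_3a_4$, $L:=\sqrt{p_1p_2p_3p_4}$, $K_0:=x_1x_2x_3x_4$, $L_0:=\sqrt{q_1q_2q_3q_4}$. Let $n\ge 0$ be an integer and assume that no denominator below vanishes. Then $$\prod_{i=1}^4\frac{(x_i^2;q_i)_{n+1}}{(K_0/x_i^2;L_0/q_i)_{n+1}}\Biggl(-1+\sum_{k=1}^n\Gamma_{k-1}[\bar a;\bar p]\,\frac{1-KL^{k-1}}{KL^{k-1}}\prod_{i=1}^4\frac{(a_i^2;p_i)_{k-1}}{(K/a_i^2;L/p_i)_k}\,\frac{((L_0/q_i)^{-n}x_i^2/K_0;L_0/q_i)_k}{(q_i^{-n}/x_i^2;q_i)_k}\Biggr)$$ $$=\prod_{i=1}^4\frac{(a_i^2;p_i)_n}{(K/a_i^2;L/p_i)_n}\Biggl(-1+\sum_{k=0}^n\Gamma_k[\bar x;\bar q]\,\frac{1-K_0L_0^k}{K_0L_0^k}\prod_{i=1}^4\frac{(x_i^2;q_i)_k}{(K_0/x_i^2;L_0/q_i)_{k+1}}\,\frac{((L/p_i)^{1-n}a_i^2/K;L/p_i)_k}{(p_i^{1-n}/a_i^2;p_i)_k}\Biggr).$$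
   Context: For a nonzero base $q$ and an integer $m\ge 0$, $(a;q)_m=\prod_{j=0}^{m-1}(1-aq^j)$. For any integer $k\ge 0$, $$\Gamma_k[\bar x;\bar q]:=\bigl(x_1x_2(q_1q_2)^{k/2}-x_3x_4(q_3q_4)^{k/2}\bigr)\bigl(x_1x_3(q_1q_3)^{k/2}-x_2x_4(q_2q_4)^{k/2}\bigr)\bigl(x_1x_4(q_1q_4)^{k/2}-x_2x_3(q_2q_3)^{k/2}\bigr),$$ and $\Gamma_k[\bar a;\bar p]$ is the same expression with $(x_i,q_i)$ replaced by $(a_i,p_i)$. Square roots are taken consistently: fix a square root $q_i^{1/2}$ of each $q_i$ and $p_i^{1/2}$ of each $p_i$; then $(q_iq_j)^{k/2}=(q_i^{1/2}q_j^{1/2})^k$, $L_0=\prod_i q_i^{1/2}$, and similarly $(p_ip_j)^{k/2}=(p_i^{1/2}p_j^{1/2})^k$, $L=\prod_i p_i^{1/2}$. Empty sums are $0$. *)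

theory Defs
  imports "HOL-Analysis.Analysis"
begin

definition qpoch :: "complex \<Rightarrow> complex \<Rightarrow> nat \<Rightarrow> complex" where
  "qpoch a q m = (\<Prod>j<m. 1 - a * q ^ j)"

text \<open>
  \<open>Gam k x r\<close> is \<open>\<Gamma>\<^sub>k[x; q]\<close>, where the vector \<open>r\<close> consists of the fixed square
  roots \<open>r $ i\<close> of the bases \<open>q $ i\<close>. Thus \<open>(q\<^sub>i q\<^sub>j)\<^bsup>k/2\<^esup>\<close> is
  \<open>(r $ i * r $ j) ^ k\<close>; all half-integer powers refer to the same choice of roots.
\<close>

definition Gam :: "nat \<Rightarrow> complex ^ 4 \<Rightarrow> complex ^ 4 \<Rightarrow> complex" where
  "Gam k x r =
     (x$1 * x$2 * (r$1 * r$2) ^ k - x$3 * x$4 * (r$3 * r$4) ^ k) *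
     (x$1 * x$3 * (r$1 * r$3) ^ k - x$2 * x$4 * (r$2 * r$4) ^ k) *
     (x$1 * x$4 * (r$1 * r$4) ^ k - x$2 * x$3 * (r$2 * r$3) ^ k)"

end

theory Submission
  imports Defs
begin

text \<open>
  Let \<open>u\<^sub>k = \<Prod>\<^sub>i (a\<^sub>i\<^sup>2;p\<^sub>i)\<^sub>k / (K/a\<^sub>i\<^sup>2;L/p\<^sub>i)\<^sub>k\<close>, and let \<open>w\<^sub>k\<close> be the same quotient for \<open>x\<close>, \<open>q\<close>.
  Since \<open>\<Prod>\<^sub>i (1 - A\<^sub>i\<^sup>2) - \<Prod>\<^sub>i (1 - \<kappa>/A\<^sub>i\<^sup>2)\<close> with \<open>\<kappa> = A\<^sub>1A\<^sub>2A\<^sub>3A\<^sub>4\<close> factors completely, the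
  terms containing \<open>\<Gamma>\<close> are the differences \<open>u\<^sub>k\<^sub>-\<^sub>1 - u\<^sub>k\<close> and \<open>w\<^sub>k - w\<^sub>k\<^sub>+\<^sub>1\<close>. Reversing the order of the
  factors turns the remaining quotients into \<open>w\<^sub>n\<^sub>+\<^sub>1\<^sub>-\<^sub>k / w\<^sub>n\<^sub>+\<^sub>1\<close> and \<open>u\<^sub>n\<^sub>-\<^sub>k / u\<^sub>n\<close>, and the theorem becomes
  summation by parts.
\<close>

text \<open>The bases enter through their square roots \<open>r\<close>, as in \<open>Gam\<close>.
  Hence the product of the entries of \<open>r\<close> is L itself, with the chosen sign, and one
  choice of roots governs both functions.\<close>

definition qquot :: "complex ^ 4 \<Rightarrow> complex ^ 4 \<Rightarrow> nat \<Rightarrow> complex" where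
  "qquot x r m = (\<Prod>i\<in>UNIV. qpoch ((x $ i)\<^sup>2) ((r $ i)\<^sup>2) m
     / qpoch ((\<Prod>j\<in>UNIV. x $ j) / (x $ i)\<^sup>2) ((\<Prod>j\<in>UNIV. r $ j) / (r $ i)\<^sup>2) m)"

lemma qpoch_0 [simp]: "qpoch a q 0 = 1"
  by (simp add: qpoch_def)

lemma qpoch_Suc: "qpoch a q (Suc m) = qpoch a q m * (1 - a * q ^ m)"
  by (simp add: qpoch_def)

lemma qquot_0 [simp]: "qquot x r 0 = 1"
  by (simp add: qquot_def)

lemma prod_UNIV_4: "(\<Prod>i\<in>(UNIV :: 4 set). f i) = f 1 * f 2 * f 3 * (f 4 :: 'a :: comm_monoid_mult)"
  unfolding UNIV_4 by (simp add: ac_simps)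

lemma Gam_0_factorization:
  fixes A :: "complex ^ 4"
  assumes nz: "\<And>i. A $ i \<noteq> 0" and k: "k = (\<Prod>i\<in>UNIV. A $ i)"
  shows "(\<Prod>i\<in>UNIV. 1 - k / (A $ i)\<^sup>2) - (\<Prod>i\<in>UNIV. 1 - (A $ i)\<^sup>2) = Gam 0 A r * ((1 - k) / k)"
proof -
  define a b c d where abcd: "a = A $ 1" "b = A $ 2" "c = A $ 3" "d = A $ 4"
  have nz': "a \<noteq> 0" "b \<noteq> 0" "c \<noteq> 0" "d \<noteq> 0"
    using nz abcd by auto
  have k': "k = a * b * c * d"
    by (simp add: k prod_UNIV_4 abcd)
  then have "k \<noteq> 0"
    using nz' by simp
  have quot: "1 - k / a\<^sup>2 = (a - b * c * d) / a" "1 - k / b\<^sup>2 = (b - a * c * d) / b"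
    "1 - k / c\<^sup>2 = (c - a * b * d) / c" "1 - k / d\<^sup>2 = (d - a * b * c) / d"
    using nz' by (simp_all add: k' diff_divide_distrib power2_eq_square)
  \<comment> \<open>Clearing the denominators, whose product is k, leaves a polynomial identity in
    four variables.\<close>
  have id: "(a - b * c * d) * (b - a * c * d) * (c - a * b * d) * (d - a * b * c)
      - ((1 - a\<^sup>2) * (1 - b\<^sup>2) * (1 - c\<^sup>2) * (1 - d\<^sup>2)) * k
    = (a * b - c * d) * (a * c - b * d) * (a * d - b * c) * (1 - k)"
    by (simp add: k' algebra_simps power2_eq_square)
  have "P / k - Q = G * ((1 - k) / k)" if "P - Q * k = G * (1 - k)" for P Q G
  proof -
    have "P = Q * k + G * (1 - k)"
      using that by (simp add: diff_eq_eq)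
    then show ?thesis
      using \<open>k \<noteq> 0\<close> by (simp add: add_divide_distrib)
  qed
  from this [OF id] show ?thesis
    unfolding prod_UNIV_4 Gam_def abcd [symmetric] quot times_divide_times_eq power_0 mult_1_right
      k' [symmetric] .
qed

lemma Gam_telescope:
  fixes x r :: "complex ^ 4"
  assumes nz: "\<And>i. x $ i \<noteq> 0" "\<And>i. r $ i \<noteq> 0"
    and K: "K = (\<Prod>i\<in>UNIV. x $ i)" and L: "L = (\<Prod>i\<in>UNIV. r $ i)"
    and den: "\<And>i. qpoch (K / (x $ i)\<^sup>2) (L / (r $ i)\<^sup>2) (Suc k) \<noteq> 0"
  shows "Gam k x r * ((1 - K * L ^ k) / (K * L ^ k)) *
      (\<Prod>i\<in>UNIV. qpoch ((x $ i)\<^sup>2) ((r $ i)\<^sup>2) k / qpoch (K / (x $ i)\<^sup>2) (L / (r $ i)\<^sup>2) (Suc k))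
    = qquot x r k - qquot x r (Suc k)"
proof -
  define A :: "complex ^ 4" where "A = (\<chi> i. x $ i * (r $ i) ^ k)"
  have A: "A $ i = x $ i * (r $ i) ^ k" for i
    by (simp add: A_def)
  have kappa: "K * L ^ k = (\<Prod>i\<in>UNIV. A $ i)"
    by (simp add: K L A prod.distrib prod_power_distrib)
  have Gam: "Gam k x r = Gam 0 A r"
    by (simp add: Gam_def A power_mult_distrib mult_ac)
  define N where "N i = qpoch ((x $ i)\<^sup>2) ((r $ i)\<^sup>2) k" for i
  define D where "D i = qpoch (K / (x $ i)\<^sup>2) (L / (r $ i)\<^sup>2) k" for i
  define c where "c i = 1 - K * L ^ k / (A $ i)\<^sup>2" for i
  have den_eq: "qpoch (K / (x $ i)\<^sup>2) (L / (r $ i)\<^sup>2) (Suc k) = D i * c i" for i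
    by (simp add: qpoch_Suc D_def c_def A power_mult_distrib power_divide power_commutes
        flip: power_mult) (simp add: mult_ac)
  have num_eq: "qpoch ((x $ i)\<^sup>2) ((r $ i)\<^sup>2) (Suc k) = N i * (1 - (A $ i)\<^sup>2)" for i
    by (simp add: qpoch_Suc N_def A power_mult_distrib flip: power_mult) (simp add: mult_ac)
  have c: "c i \<noteq> 0" for i
    using den [of i] by (simp add: den_eq)
  have "Gam k x r * ((1 - K * L ^ k) / (K * L ^ k)) * (\<Prod>i\<in>UNIV. N i / (D i * c i))
      = ((\<Prod>i\<in>UNIV. c i) - (\<Prod>i\<in>UNIV. 1 - (A $ i)\<^sup>2)) * (\<Prod>i\<in>UNIV. N i / (D i * c i))"
    using Gam_0_factorization [of A "K * L ^ k" r] nz kappa by (simp add: Gam c_def A)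
  also have "\<dots> = (\<Prod>i\<in>UNIV. c i * (N i / (D i * c i)))
      - (\<Prod>i\<in>UNIV. (1 - (A $ i)\<^sup>2) * (N i / (D i * c i)))"
    \<comment> \<open>In the first product \<open>c i\<close> cancels, which leaves index k; in the
      second, the new numerator factor completes the quotient of index \<open>Suc k\<close>.\<close>
    by (subst left_diff_distrib) (simp only: prod.distrib)
  also have "(\<Prod>i\<in>UNIV. c i * (N i / (D i * c i))) = qquot x r k"
    using c by (simp add: qquot_def N_def D_def K L)
  also have "(\<Prod>i\<in>UNIV. (1 - (A $ i)\<^sup>2) * (N i / (D i * c i))) = qquot x r (Suc k)"
    unfolding qquot_def K [symmetric] L [symmetric] num_eq den_eq by (simp add: mult_ac)
  finally show ?thesis
    unfolding den_eq N_def .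
qed

text \<open>The last k factors are rewritten by 1 - b = -b (1 - 1/b). Read backwards, the inverses
  of b = a q^(m-1-j) form a geometric progression with ratio q that starts at q^(1-m)/a.\<close>

lemma qpoch_reverse:
  assumes "a \<noteq> 0" "q \<noteq> 0" "k \<le> m"
  shows "qpoch a q m
    = qpoch a q (m - k) * (\<Prod>j<k. - (a * q ^ (m - 1 - j))) * qpoch (q powi (1 - int m) / a) q k"
  using \<open>k \<le> m\<close>
proof (induction k)
  case (Suc k)
  define l where "l = m - Suc k"
  have l: "m - k = Suc l" "m - 1 - k = l" "m = Suc (l + k)"
    using Suc.prems by (auto simp: l_def)
  \<comment> \<open>The exponent 1 - m + k equals -l.\<close>
  have "q powi (1 - int m) * q ^ k = inverse (q ^ l)"
    using \<open>q \<noteq> 0\<close> by (simp add: l power_int_diff power_int_add power_int_minus field_simps)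
  then have "1 - a * q ^ l = - (a * q ^ l) * (1 - q powi (1 - int m) / a * q ^ k)"
    using assms by (simp add: field_simps)
  with Suc show ?case
    by (simp add: qpoch_Suc l mult_ac flip: l_def)
qed simp

text \<open>Applying \<open>qpoch_reverse\<close> to numerators and denominators cancels the
  reversed symbols and leaves the monomials \<open>s i\<close> and \<open>t i\<close>. They need not
  agree for a single i, but their products over i do.\<close>

lemma qquot_reverse:
  fixes x r :: "complex ^ 4"
  assumes nz: "\<And>i. x $ i \<noteq> 0" "\<And>i. r $ i \<noteq> 0" and "k \<le> m"
    and K: "K = (\<Prod>i\<in>UNIV. x $ i)" and L: "L = (\<Prod>i\<in>UNIV. r $ i)"
    and den: "\<And>i. qpoch (K / (x $ i)\<^sup>2) (L / (r $ i)\<^sup>2) m \<noteq> 0"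
    and den': "\<And>i. qpoch (((r $ i)\<^sup>2) powi (1 - int m) / (x $ i)\<^sup>2) ((r $ i)\<^sup>2) k \<noteq> 0"
  shows "qquot x r m *
      (\<Prod>i\<in>UNIV. qpoch ((L / (r $ i)\<^sup>2) powi (1 - int m) * (x $ i)\<^sup>2 / K) (L / (r $ i)\<^sup>2) k
        / qpoch (((r $ i)\<^sup>2) powi (1 - int m) / (x $ i)\<^sup>2) ((r $ i)\<^sup>2) k)
    = qquot x r (m - k)"
proof -
  have KL: "K \<noteq> 0" "L \<noteq> 0"
    using nz by (simp_all add: K L)
  define N D where "N l i = qpoch ((x $ i)\<^sup>2) ((r $ i)\<^sup>2) l"
    and "D l i = qpoch (K / (x $ i)\<^sup>2) (L / (r $ i)\<^sup>2) l" for l i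
  define N' D' where "N' i = qpoch (((r $ i)\<^sup>2) powi (1 - int m) / (x $ i)\<^sup>2) ((r $ i)\<^sup>2) k"
    and "D' i = qpoch ((L / (r $ i)\<^sup>2) powi (1 - int m) * (x $ i)\<^sup>2 / K) (L / (r $ i)\<^sup>2) k" for i
  define s t where "s i = (\<Prod>j<k. - ((x $ i)\<^sup>2 * ((r $ i)\<^sup>2) ^ (m - 1 - j)))"
    and "t i = (\<Prod>j<k. - (K / (x $ i)\<^sup>2 * (L / (r $ i)\<^sup>2) ^ (m - 1 - j)))" for i
  have N: "N m i = N (m - k) i * s i * N' i" for i
    unfolding N_def s_def N'_def using nz \<open>k \<le> m\<close> by (intro qpoch_reverse) auto
  have D: "D m i = D (m - k) i * t i * D' i" for i
    using qpoch_reverse [of "K / (x $ i)\<^sup>2" "L / (r $ i)\<^sup>2" k m] nz KL \<open>k \<le> m\<close>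
    unfolding D_def t_def D'_def by simp
  have st_j: "(\<Prod>i\<in>UNIV. - ((x $ i)\<^sup>2 * ((r $ i)\<^sup>2) ^ e))
      = (\<Prod>i\<in>UNIV. - (K / (x $ i)\<^sup>2 * (L / (r $ i)\<^sup>2) ^ e))" for e
  proof -
    \<comment> \<open>This uses that there are four entries: K^4 / K^2 = K^2, and likewise for
      L.\<close>
    have "(\<Prod>i\<in>UNIV. K / (x $ i)\<^sup>2) = (\<Prod>i\<in>UNIV. (x $ i)\<^sup>2)"
      "(\<Prod>i\<in>UNIV. L / (r $ i)\<^sup>2) = (\<Prod>i\<in>UNIV. (r $ i)\<^sup>2)"
      using nz by (simp_all add: K L prod_UNIV_4 field_simps power2_eq_square)
    then show ?thesis
      by (simp only: minus_mult_left prod.distrib prod_power_distrib [symmetric] prod_uminus)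
  qed
  have st: "(\<Prod>i\<in>UNIV. s i) = (\<Prod>i\<in>UNIV. t i)"
    unfolding s_def t_def by (subst (1 2) prod.swap) (simp only: st_j)
  have nz_D: "D (m - k) i \<noteq> 0" "t i \<noteq> 0" "D' i \<noteq> 0" "N' i \<noteq> 0" for i
    using den [of i] den' [of i] D [of i] by (auto simp: D_def N'_def)
  have "(\<Prod>i\<in>UNIV. N m i / D m i) * (\<Prod>i\<in>UNIV. D' i / N' i)
      = (\<Prod>i\<in>UNIV. N (m - k) i / D (m - k) i * (s i / t i))"
    unfolding prod.distrib [symmetric] N D using nz_D by (intro prod.cong) (auto simp: field_simps)
  also have "\<dots> = (\<Prod>i\<in>UNIV. N (m - k) i / D (m - k) i)"
    using nz_D by (simp add: prod.distrib prod_dividef st)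
  finally show ?thesis
    by (simp add: qquot_def N_def D_def N'_def D'_def K L)
qed

text \<open>Both sums are differences of convolutions of u and w with total index n and n + 1. The
  ranges differ by boundary terms, which are u n and w (n + 1) because both sequences start at
  1.\<close>

lemma convolution_by_parts:
  fixes u w :: "nat \<Rightarrow> complex"
  assumes "u 0 = 1" "w 0 = 1"
  shows "- w (Suc n) + (\<Sum>k = 1..n. (u (k - 1) - u k) * w (Suc n - k))
    = - u n + (\<Sum>k = 0..n. (w k - w (Suc k)) * u (n - k))"
proof -
  have "(\<Sum>k = 0..n. (w k - w (Suc k)) * u (n - k)) = (\<Sum>k = 0..n. (w (n - k) - w (Suc n - k)) * u k)"
    by (subst sum.atLeastAtMost_rev) (auto intro!: sum.cong simp: Suc_diff_le)
  also have "\<dots> = (\<Sum>k = 0..n. u k * w (n - k)) - (\<Sum>k = 0..n. u k * w (Suc n - k))"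
    by (simp add: algebra_simps sum_subtractf)
  also have "(\<Sum>k = 0..n. u k * w (n - k)) = u n + (\<Sum>k<n. u k * w (n - k))"
    using assms by (simp add: atLeast0AtMost flip: lessThan_Suc_atMost)
  also have "(\<Sum>k<n. u k * w (n - k)) = (\<Sum>k = 1..n. u (k - 1) * w (Suc n - k))"
    by (rule sum.reindex_bij_witness [of _ "\<lambda>k. k - 1" Suc]) auto
  also have "(\<Sum>k = 0..n. u k * w (Suc n - k)) = w (Suc n) + (\<Sum>k = 1..n. u k * w (Suc n - k))"
    using assms by (simp add: sum.atLeast_Suc_atMost)
  finally show ?thesis
    by (simp add: algebra_simps sum_subtractf)
qed

theorem theorem2p4:
  fixes a p x q rp rq :: "complex ^ 4"
    and K L K0 L0 :: complex
    and n :: nat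
  assumes root_p: "\<And>i. (rp $ i)\<^sup>2 = p $ i"
    and root_q: "\<And>i. (rq $ i)\<^sup>2 = q $ i"
    and nonzero: "\<And>i. a $ i * x $ i * p $ i * q $ i \<noteq> 0"
    and K: "K = (\<Prod>i\<in>UNIV. a $ i)"
    and L: "L = (\<Prod>i\<in>UNIV. rp $ i)"
    and K0: "K0 = (\<Prod>i\<in>UNIV. x $ i)"
    and L0: "L0 = (\<Prod>i\<in>UNIV. rq $ i)"
    and denom_x: "\<And>i k. k \<le> n + 1 \<Longrightarrow> qpoch (K0 / (x $ i)\<^sup>2) (L0 / q $ i) k \<noteq> 0"
    and denom_a: "\<And>i k. k \<le> n \<Longrightarrow> qpoch (K / (a $ i)\<^sup>2) (L / p $ i) k \<noteq> 0"
    and denom_x': "\<And>i k. k \<le> n \<Longrightarrow>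
      qpoch ((q $ i) powi (- int n) / (x $ i)\<^sup>2) (q $ i) k \<noteq> 0"
    and denom_a': "\<And>i k. k \<le> n \<Longrightarrow>
      qpoch ((p $ i) powi (1 - int n) / (a $ i)\<^sup>2) (p $ i) k \<noteq> 0"
  shows
    "(\<Prod>i\<in>UNIV. qpoch ((x $ i)\<^sup>2) (q $ i) (n + 1)
                  / qpoch (K0 / (x $ i)\<^sup>2) (L0 / q $ i) (n + 1)) *
     (- 1 + (\<Sum>k = 1..n.
        Gam (k - 1) a rp * ((1 - K * L ^ (k - 1)) / (K * L ^ (k - 1))) *
        (\<Prod>i\<in>UNIV.
           (qpoch ((a $ i)\<^sup>2) (p $ i) (k - 1)
              / qpoch (K / (a $ i)\<^sup>2) (L / p $ i) k) *
           (qpoch ((L0 / q $ i) powi (- int n) * (x $ i)\<^sup>2 / K0) (L0 / q $ i) k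
              / qpoch ((q $ i) powi (- int n) / (x $ i)\<^sup>2) (q $ i) k))))
     =
     (\<Prod>i\<in>UNIV. qpoch ((a $ i)\<^sup>2) (p $ i) n
                  / qpoch (K / (a $ i)\<^sup>2) (L / p $ i) n) *
     (- 1 + (\<Sum>k = 0..n.
        Gam k x rq * ((1 - K0 * L0 ^ k) / (K0 * L0 ^ k)) *
        (\<Prod>i\<in>UNIV.
           (qpoch ((x $ i)\<^sup>2) (q $ i) k
              / qpoch (K0 / (x $ i)\<^sup>2) (L0 / q $ i) (k + 1)) *
           (qpoch ((L / p $ i) powi (1 - int n) * (a $ i)\<^sup>2 / K) (L / p $ i) k
              / qpoch ((p $ i) powi (1 - int n) / (a $ i)\<^sup>2) (p $ i) k))))"
proof -
  have p: "p $ i = (rp $ i)\<^sup>2" and q: "q $ i = (rq $ i)\<^sup>2" for i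
    using root_p root_q by simp_all
  have nz: "a $ i \<noteq> 0" "x $ i \<noteq> 0" "rp $ i \<noteq> 0" "rq $ i \<noteq> 0" for i
    using nonzero [of i] by (auto simp: p q)
  let ?u = "qquot a rp" and ?w = "qquot x rq"
  have u: "(\<Prod>i\<in>UNIV. qpoch ((a $ i)\<^sup>2) (p $ i) n / qpoch (K / (a $ i)\<^sup>2) (L / p $ i) n) = ?u n"
    by (simp add: qquot_def p K L)
  have w: "(\<Prod>i\<in>UNIV. qpoch ((x $ i)\<^sup>2) (q $ i) (n + 1)
      / qpoch (K0 / (x $ i)\<^sup>2) (L0 / q $ i) (n + 1)) = ?w (Suc n)"
    by (simp add: qquot_def q K0 L0)
  \<comment> \<open>The prefactor is moved into each summand. Reversal is used with m =
    \<open>Suc n\<close>, where 1 - m is the exponent -n; in \<open>rhs\<close> below it is used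
    with m = n, which gives 1 - n.\<close>
  have lhs: "?w (Suc n) * (Gam (k - 1) a rp * ((1 - K * L ^ (k - 1)) / (K * L ^ (k - 1))) *
        (\<Prod>i\<in>UNIV.
           (qpoch ((a $ i)\<^sup>2) (p $ i) (k - 1)
              / qpoch (K / (a $ i)\<^sup>2) (L / p $ i) k) *
           (qpoch ((L0 / q $ i) powi (- int n) * (x $ i)\<^sup>2 / K0) (L0 / q $ i) k
              / qpoch ((q $ i) powi (- int n) / (x $ i)\<^sup>2) (q $ i) k)))
      = (?u (k - 1) - ?u k) * ?w (Suc n - k)" if "k \<in> {1..n}" for k
  proof -
    have k: "Suc (k - 1) = k"
      using that by simp
    have "Gam (k - 1) a rp * ((1 - K * L ^ (k - 1)) / (K * L ^ (k - 1))) *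
        (\<Prod>i\<in>UNIV. qpoch ((a $ i)\<^sup>2) (p $ i) (k - 1) / qpoch (K / (a $ i)\<^sup>2) (L / p $ i) k)
      = ?u (k - 1) - ?u k"
      using Gam_telescope [of a rp K L "k - 1"] nz K L denom_a [of k] that
      unfolding k p by simp
    moreover have "?w (Suc n) *
        (\<Prod>i\<in>UNIV. qpoch ((L0 / q $ i) powi (- int n) * (x $ i)\<^sup>2 / K0) (L0 / q $ i) k
           / qpoch ((q $ i) powi (- int n) / (x $ i)\<^sup>2) (q $ i) k) = ?w (Suc n - k)"
      using qquot_reverse [of x rq k "Suc n" K0 L0] nz K0 L0 denom_x [of "Suc n"] denom_x' [of k] that
      unfolding q by simp
    moreover have "c * (g * (y * z)) = (g * y) * (c * z)" for c g y z :: complex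
      by simp
    ultimately show ?thesis
      unfolding prod.distrib by (simp only:)
  qed
  have rhs: "?u n * (Gam k x rq * ((1 - K0 * L0 ^ k) / (K0 * L0 ^ k)) *
        (\<Prod>i\<in>UNIV.
           (qpoch ((x $ i)\<^sup>2) (q $ i) k
              / qpoch (K0 / (x $ i)\<^sup>2) (L0 / q $ i) (k + 1)) *
           (qpoch ((L / p $ i) powi (1 - int n) * (a $ i)\<^sup>2 / K) (L / p $ i) k
              / qpoch ((p $ i) powi (1 - int n) / (a $ i)\<^sup>2) (p $ i) k)))
      = (?w k - ?w (Suc k)) * ?u (n - k)" if "k \<in> {0..n}" for k
  proof -
    have "Gam k x rq * ((1 - K0 * L0 ^ k) / (K0 * L0 ^ k)) *
        (\<Prod>i\<in>UNIV. qpoch ((x $ i)\<^sup>2) (q $ i) k / qpoch (K0 / (x $ i)\<^sup>2) (L0 / q $ i) (k + 1))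
      = ?w k - ?w (Suc k)"
      using Gam_telescope [of x rq K0 L0 k] nz K0 L0 denom_x [of "Suc k"] that
      unfolding q by simp
    moreover have "?u n *
        (\<Prod>i\<in>UNIV. qpoch ((L / p $ i) powi (1 - int n) * (a $ i)\<^sup>2 / K) (L / p $ i) k
           / qpoch ((p $ i) powi (1 - int n) / (a $ i)\<^sup>2) (p $ i) k) = ?u (n - k)"
      using qquot_reverse [of a rp k n K L] nz K L denom_a [of n] denom_a' [of k] that
      unfolding p by simp
    moreover have "c * (g * (y * z)) = (g * y) * (c * z)" for c g y z :: complex
      by simp
    ultimately show ?thesis
      unfolding prod.distrib by (simp only:)
  qed
  \<comment> \<open>After distributing the prefactors, the two constants -1 supply the boundary
    terms of the summation by parts.\<close>
  show ?thesis
    using convolution_by_parts [of ?u ?w n]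
    by (simp only: u w distrib_left sum_distrib_left lhs rhs qquot_0 mult_minus1_right cong: sum.cong)
qed

end
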